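(* Let $F$ be a field of characteristic $0$. Every injective Rota--Baxter operator of weight zero on the polynomial algebra $F[x]$ equals $J_a\circ l_r$ for some nonzero polynomial $r\in F[x]$ and some $a\in F$.
   Context: A Rota--Baxter operator of weight zero on an algebra $A$ over $F$ is a linear operator $R\colon A\to A$ such that $R(f)R(g)=R\big(R(f)g+fR(g)\big)$ for all $f,g\in A$. On $F[x]$: for $r\in F[x]$, $l_r\colon f\mapsto rf$ is the multiplication operator; for $a\in F$, $J_a$ is the linear operator (formal integration at $a$) defined by $J_a(x^n)=\dfrac{x^{n+1}-a^{n+1}}{n+1}$ for all $n\ge 0$. The symbol $\circ$ denotes composition of operators. *)

theory Defs
  imports "HOL-Computational_Algebra.Polynomial"
begin

locale algebra_over = vector_space scale
  for scale :: "'f::field \<Rightarrow> 'a::ring \<Rightarrow> 'a" +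
  assumes scale_mult_left: "scale c f * g = scale c (f * g)"
    and scale_mult_right: "f * scale c g = scale c (f * g)"

locale rota_baxter_weight_zero =
  algebra_over scale + Vector_Spaces.linear scale scale R
  for scale :: "'f::field \<Rightarrow> 'a::ring \<Rightarrow> 'a" and R :: "'a \<Rightarrow> 'a" +
  assumes rota_baxter: "R f * R g = R (R f * g + f * R g)"

lemma vector_space_smult: "vector_space (smult :: 'a::field \<Rightarrow> _)"
  by unfold_locales (simp_all add: smult_add_left smult_add_right)

lemma algebra_over_smult: "algebra_over (smult :: 'a::field \<Rightarrow> _)"
proof -
  interpret vector_space "smult :: 'a \<Rightarrow> _"
    by (rule vector_space_smult)
  show ?thesis
    by unfold_locales simp_all
qed

text \<open>
  Formal integration at \<open>a\<close>: the linear operator with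
  \<open>x\<^sup>n \<mapsto> (x\<^sup>n\<^sup>+\<^sup>1 - a\<^sup>n\<^sup>+\<^sup>1) / (n + 1)\<close>, written out on the
  expansion of a polynomial in the basis of monomials. The lemmas below confirm linearity
  and the values on this basis.
\<close>

definition formal_integral :: "'a::field_char_0 \<Rightarrow> 'a poly \<Rightarrow> 'a poly" where
  "formal_integral a f =
    (\<Sum>n\<le>degree f. smult (coeff f n)
      (smult (1 / of_nat (n + 1)) (monom 1 (n + 1) - [:a ^ (n + 1):])))"

lemma formal_integral_eq:
  assumes "degree f \<le> N"
  shows "formal_integral a f =
    (\<Sum>n\<le>N. smult (coeff f n)
      (smult (1 / of_nat (n + 1)) (monom 1 (n + 1) - [:a ^ (n + 1):])))"
  unfolding formal_integral_def
  using assms by (intro sum.mono_neutral_left) (auto simp: coeff_eq_0)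

lemma formal_integral_monom:
  "formal_integral a (monom 1 n) =
    smult (1 / of_nat (n + 1)) (monom 1 (n + 1) - [:a ^ (n + 1):])"
proof -
  have "formal_integral a (monom 1 n) =
      (\<Sum>k\<le>n. if k = n
        then smult (1 / of_nat (n + 1)) (monom 1 (n + 1) - [:a ^ (n + 1):]) else 0)"
    unfolding formal_integral_eq[OF degree_monom_le]
    by (rule sum.cong) auto
  then show ?thesis
    by simp
qed

lemma linear_formal_integral:
  "Vector_Spaces.linear smult smult (formal_integral (a::'a::field_char_0))"
proof -
  interpret vector_space "smult :: 'a \<Rightarrow> _"
    by (rule vector_space_smult)
  have "formal_integral a (f + g) = formal_integral a f + formal_integral a g" for f g
    using degree_add_le_max[of f g]
    by (simp add: formal_integral_eq[where N = "max (degree f) (degree g)"]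
        smult_add_left add_divide_distrib sum.distrib)
  moreover have "formal_integral a (smult c f) = smult c (formal_integral a f)" for c f
    by (simp add: formal_integral_eq[where N = "degree f"] scale_sum_right mult_ac)
  ultimately show ?thesis
    by unfold_locales auto
qed

end

theory Submission
  imports Defs
begin

text \<open>
  Let \<open>R\<close> be an injective Rota--Baxter operator of weight zero on \<open>F[x]\<close>. The Rota--Baxter
  identity says that the image of \<open>R\<close> is closed under multiplication and that the inverse of
  \<open>R\<close> is a derivation there; adjoining the constants gives a unital subalgebra \<open>T\<close> of \<open>F[x]\<close>
  with a derivation into \<open>F[x]\<close>.

  Two polynomials are always algebraically dependent, so a derivation on a subalgebra of
  \<open>F[x]\<close> is a multiple of \<open>d/dx\<close> by a rational function, determined by its value at one
  nonconstant element (\<open>D_proportional_pderiv\<close>). Here the derivation sends \<open>R 1\<close> to \<open>1\<close>,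
  so with \<open>r = (R 1)'\<close> it follows that \<open>(R f)' = r f\<close> for all \<open>f\<close>. Thus \<open>R f\<close> is
  an antiderivative of \<open>r f\<close>, and only its constant term remains to be determined.

  Consequently \<open>T\<close> is the algebra of all \<open>w\<close> whose derivative is divisible by \<open>r\<close>, and it is the
  direct sum of the constants and the image of \<open>R\<close>. As this image is closed under
  multiplication, the projection of \<open>T\<close> to the constants is a character. Every character of
  \<open>T\<close> is evaluation at a point \<open>a\<close> of \<open>F\<close> (\<open>character_is_evaluation\<close>); hence all \<open>R f\<close>
  vanish at \<open>a\<close>, which means \<open>R f = J\<^sub>a (r f)\<close>.

  A general lying-over argument would only yield \<open>a\<close> in an algebraic closure of \<open>F\<close>. To find
  \<open>a\<close> in \<open>F\<close> itself, two cases are distinguished. The ideal of \<open>F[x]\<close> generated by \<open>r\<^sup>2\<close> is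
  contained in \<open>T\<close>. If the character is nonzero at some \<open>h\<close> in it, then
  \<open>f \<mapsto> \<chi>(f h) / \<chi>(h)\<close> extends \<open>\<chi>\<close> to \<open>F[x]\<close>, whose characters are evaluations.
  Otherwise let \<open>s\<close> be the radical of \<open>r\<close>. A Newton iteration produces \<open>y\<close> congruent to \<open>x\<close>
  modulo \<open>s\<close> with \<open>y'\<close> divisible by \<open>r\<close> (\<open>flat_lift_exists\<close>). For each \<open>w\<close> in \<open>T\<close>, some power
  of \<open>w(y) - w\<close> is divisible by \<open>r\<^sup>2\<close>, so \<open>\<chi>\<close> takes the same value at \<open>w\<close> as at \<open>w(y)\<close>,
  and since \<open>y\<close> itself lies in \<open>T\<close> this value is \<open>w(\<chi>(y))\<close>.
\<close>

section \<open>Derivations on subalgebras of a polynomial algebra\<close>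

text \<open>
  A derivation into \<open>F[x]\<close> from the unital subalgebra on which it is defined, given by its
  graph. As a relation it needs neither a carrier set nor arbitrary values outside the subalgebra.
\<close>

locale derivation_relation =
  fixes D :: "'a::field_char_0 poly \<Rightarrow> 'a poly \<Rightarrow> bool"
  assumes D_const: "D [:c:] 0"
    and D_add: "D w e \<Longrightarrow> D w' e' \<Longrightarrow> D (w + w') (e + e')"
    and D_mult: "D w e \<Longrightarrow> D w' e' \<Longrightarrow> D (w * w') (w * e' + e * w')"

lemma derivation_relation_pderiv:
  "derivation_relation (\<lambda>w e. pderiv w = (e :: 'a::field_char_0 poly))"
  by unfold_locales (simp_all add: pderiv_add pderiv_mult pderiv_pCons mult.commute)

text \<open>
  The value \<open>P(u, v)\<close> of a polynomial in two variables. The first variable is the inner one, the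
  second the outer one, so that \<open>pderiv P\<close> and \<open>map_poly pderiv P\<close> are the partial
  derivatives with respect to the second and the first variable.
\<close>

definition eval2 :: "'a::field_char_0 poly \<Rightarrow> 'a poly \<Rightarrow> 'a poly poly \<Rightarrow> 'a poly" where
  "eval2 u v P = poly (map_poly (\<lambda>c. c \<circ>\<^sub>p u) P) v"

lemma eval2_0 [simp]: "eval2 u v 0 = 0"
  by (simp add: eval2_def)

lemma eval2_pCons [simp]: "eval2 u v (pCons c P) = c \<circ>\<^sub>p u + v * eval2 u v P"
  by (simp add: eval2_def map_poly_pCons)

lemma eval2_add: "eval2 u v (P + Q) = eval2 u v P + eval2 u v Q"
proof -
  have "map_poly (\<lambda>c. c \<circ>\<^sub>p u) (P + Q) = map_poly (\<lambda>c. c \<circ>\<^sub>p u) P + map_poly (\<lambda>c. c \<circ>\<^sub>p u) Q"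
    by (rule poly_eqI) (simp add: coeff_map_poly pcompose_add)
  then show ?thesis by (simp add: eval2_def)
qed

lemma eval2_sum: "eval2 u v (\<Sum>i\<in>I. P i) = (\<Sum>i\<in>I. eval2 u v (P i))"
  by (induction I rule: infinite_finite_induct) (simp_all add: eval2_add)

lemma eval2_monom: "eval2 u v (monom (monom c i) j) = smult c (u ^ i * v ^ j)"
proof -
  have "monom c i \<circ>\<^sub>p u = smult c (u ^ i)"
    by (induction i) (simp_all add: monom_Suc pcompose_pCons monom_0)
  then show ?thesis
    by (simp add: eval2_def map_poly_monom poly_monom)
qed

context derivation_relation
begin

lemma D_pcompose:
  assumes "D u f"
  shows "D (p \<circ>\<^sub>p u) ((pderiv p \<circ>\<^sub>p u) * f)"
proof (induction p)
  case 0
  show ?case using D_const[of 0] by simp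
next
  case (pCons a p)
  from D_add[OF D_const D_mult[OF assms pCons(2)], of a] show ?case
    by (simp add: pcompose_pCons pderiv_pCons pcompose_add algebra_simps)
qed

text \<open>
  The chain rule. The two cofactors depend on \<open>u\<close>, \<open>v\<close> and \<open>P\<close> but not on the derivation, which
  is what makes it possible to compare two derivations.
\<close>

lemma D_eval2:
  assumes "D u f" "D v e"
  shows "D (eval2 u v P) (eval2 u v (map_poly pderiv P) * f + eval2 u v (pderiv P) * e)"
proof (induction P)
  case 0
  show ?case using D_const[of 0] by simp
next
  case (pCons c P)
  from D_add[OF D_pcompose[OF assms(1), of c] D_mult[OF assms(2) pCons(2)]] show ?case
    by (simp add: pderiv_pCons eval2_add algebra_simps map_poly_pCons)
qed

end

lemma linear_dependence_bounded_degree: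
  fixes g :: "'i \<Rightarrow> 'a::field poly"
  assumes "finite I" "\<And>i. i \<in> I \<Longrightarrow> degree (g i) \<le> N" "card I > Suc N"
  obtains c where "(\<Sum>i\<in>I. smult (c i) (g i)) = 0" "\<exists>i\<in>I. c i \<noteq> 0"
proof (cases "inj_on g I")
  case True
  interpret vector_space "smult :: 'a \<Rightarrow> _"
    by (rule vector_space_smult)
  let ?B = "(\<lambda>n. monom (1::'a) n) ` {..N}"
  have "g ` I \<subseteq> span ?B"
  proof
    fix p assume "p \<in> g ` I"
    then have "p = (\<Sum>n\<le>N. smult (coeff p n) (monom 1 n))"
      using assms(2) poly_as_sum_of_monoms'[of p N] by (auto simp: smult_monom)
    also have "\<dots> \<in> span ?B"
      by (intro span_sum span_scale span_base) auto
    finally show "p \<in> span ?B" .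
  qed
  moreover have "card ?B < card (g ` I)"
    using card_image_le[of "{..N}" "\<lambda>n. monom (1::'a) n"] assms(3) True
    by (simp add: card_image)
  ultimately have "dependent (g ` I)"
    using independent_span_bound[of ?B "g ` I"] by auto
  then obtain d where d: "\<exists>p\<in>g ` I. d p \<noteq> 0" "(\<Sum>p\<in>g ` I. smult (d p) p) = 0"
    using dependent_finite[of "g ` I"] assms(1) by auto
  show ?thesis
    using d sum.reindex[OF True, of "\<lambda>p. smult (d p) p"] by (intro that[of "d \<circ> g"]) auto
next
  case False
  then obtain k l where kl: "k \<in> I" "l \<in> I" "k \<noteq> l" "g k = g l"
    by (auto simp: inj_on_def)
  let ?c = "\<lambda>i. if i = k then 1 else if i = l then -1 else (0::'a)"
  have "(\<Sum>i\<in>I. smult (?c i) (g i)) = (\<Sum>i\<in>{k, l}. smult (?c i) (g i))"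
    using kl assms(1) by (intro sum.mono_neutral_right) auto
  also have "\<dots> = 0"
    using kl by simp
  finally show ?thesis
    using kl by (intro that[of ?c]) auto
qed

text \<open>
  A dimension count. With \<open>n\<close> and \<open>m\<close> the degrees of \<open>u\<close> and \<open>v\<close>, the products \<open>u\<^sup>i v\<^sup>j\<close> with
  \<open>i \<le> A\<close> and \<open>j \<le> n\<close> number \<open>(A + 1) (n + 1)\<close> and have degree at most \<open>A n + n m\<close>. The choice
  \<open>A = n m\<close> makes their number exceed the dimension \<open>A n + n m + 1\<close> by exactly \<open>n\<close>.
\<close>

lemma polynomials_algebraically_dependent:
  fixes u v :: "'a::field_char_0 poly"
  shows "\<exists>P. P \<noteq> 0 \<and> eval2 u v P = 0"
proof -
  define n m where "n = degree u" and "m = degree v"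
  define A where "A = n * m"
  let ?I = "{..A} \<times> {..n}"
  have deg: "degree (u ^ fst i * v ^ snd i) \<le> A * n + n * m" if "i \<in> ?I" for i
  proof -
    have "degree (u ^ fst i * v ^ snd i) \<le> n * fst i + m * snd i"
      unfolding n_def m_def
      by (intro order_trans[OF degree_mult_le] add_mono degree_power_le)
    also have "\<dots> \<le> n * A + m * n"
      using that by (intro add_mono mult_mono) auto
    finally show ?thesis by (simp add: algebra_simps)
  qed
  have "card ?I = Suc (A * n + n * m) + n"
    by (simp add: card_cartesian_product A_def algebra_simps)
  show ?thesis
  proof (cases "n = 0")
    case True
    then obtain a where "u = [:a:]"
      unfolding n_def by (rule degree_eq_zeroE)
    then have "eval2 u v [:[:-a, 1:]:] = 0"
      by (simp add: pcompose_pCons)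
    then show ?thesis
      by (intro exI[of _ "[:[:-a, 1:]:]"]) simp
  next
    case False
    with \<open>card ?I = _\<close> have card: "card ?I > Suc (A * n + n * m)" by simp
    have "finite ?I" by simp
    then obtain c where c: "(\<Sum>i\<in>?I. smult (c i) (u ^ fst i * v ^ snd i)) = 0" "\<exists>i\<in>?I. c i \<noteq> 0"
      by (rule linear_dependence_bounded_degree
          [of ?I "\<lambda>i. u ^ fst i * v ^ snd i", OF _ deg card])
    define P where "P = (\<Sum>i\<in>?I. monom (monom (c i) (fst i)) (snd i))"
    have "eval2 u v P = 0"
      using c(1) by (simp add: P_def eval2_sum eval2_monom)
    moreover have "coeff (coeff P (snd i)) (fst i) = c i" if "i \<in> ?I" for i
    proof -
      have "coeff (coeff P (snd i)) (fst i) = (\<Sum>k\<in>?I. if k = i then c i else 0)"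
        unfolding P_def coeff_sum
        by (intro sum.cong) (auto simp: prod_eq_iff)
      with that show ?thesis by simp
    qed
    ultimately show ?thesis
      using c(2) by (metis coeff_0)
  qed
qed

text \<open>
  Differentiating a relation \<open>P(u, v) = 0\<close> both by the given derivation and by \<open>d/dx\<close> gives two
  linear equations with the same coefficients \<open>\<partial>P/\<partial>u\<close> and \<open>\<partial>P/\<partial>v\<close>. If \<open>P\<close> has minimal degree in
  its second variable, then \<open>\<partial>P/\<partial>v\<close> is nonzero at \<open>(u, v)\<close>, so that the determinant of the two
  equations vanishes.
\<close>

lemma (in derivation_relation) D_proportional_pderiv:
  assumes D_0: "\<And>e. D 0 e \<Longrightarrow> e = 0"
    and "D u f" "D v e" "degree u \<noteq> 0"
  shows "f * pderiv v = e * pderiv u"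
proof -
  interpret pd: derivation_relation "\<lambda>w e. pderiv w = (e :: 'a poly)"
    by (rule derivation_relation_pderiv)
  obtain P where P: "P \<noteq> 0" "eval2 u v P = 0"
    and least: "\<And>Q. Q \<noteq> 0 \<Longrightarrow> eval2 u v Q = 0 \<Longrightarrow> degree P \<le> degree Q"
    using polynomials_algebraically_dependent[of u v]
      ex_has_least_nat[of "\<lambda>P. P \<noteq> 0 \<and> eval2 u v P = 0" _ degree] by blast
  \<comment> \<open>A relation of degree \<open>0\<close> would be an equation for \<open>u\<close> alone, but \<open>u\<close> is transcendental.\<close>
  have "degree P \<noteq> 0"
  proof
    assume "degree P = 0"
    then obtain c where "P = [:c:]"
      by (rule degree_eq_zeroE)
    with P \<open>degree u \<noteq> 0\<close> show False
      by (simp add: pcompose_eq_0_iff)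
  qed
  then have "pderiv P \<noteq> 0" "degree (pderiv P) < degree P"
    by (auto simp: pderiv_eq_0_iff degree_pderiv)
  with least have nz: "eval2 u v (pderiv P) \<noteq> 0"
    by force
  let ?a = "eval2 u v (map_poly pderiv P)" and ?b = "eval2 u v (pderiv P)"
  have 1: "?a * f + ?b * e = 0"
    using D_eval2[OF assms(2,3), of P] P(2) D_0 by simp
  have 2: "?a * pderiv u + ?b * pderiv v = 0"
    using pd.D_eval2[of u "pderiv u" v "pderiv v" P] P(2) by simp
  have "?b * (f * pderiv v - e * pderiv u) =
      f * (?a * pderiv u + ?b * pderiv v) - pderiv u * (?a * f + ?b * e)"
    by (simp add: algebra_simps)
  with 1 2 nz show ?thesis by simp
qed

section \<open>Radicals and flat lifts of the variable\<close>

text \<open>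
  A nonzero element of minimal degree in the ideal generated by \<open>a\<close> and \<open>b\<close> divides both of them.
\<close>

lemma bezout_of_no_common_divisor:
  fixes a b :: "'a::field poly"
  assumes "a \<noteq> 0" "\<And>d. d dvd a \<Longrightarrow> d dvd b \<Longrightarrow> degree d = 0"
  obtains u v where "u * a + v * b = 1"
proof -
  let ?I = "{u * a + v * b | u v. True}"
  have "a \<in> ?I" "b \<in> ?I"
    by (auto intro: exI[of _ 1] exI[of _ 0])
  then obtain d where d: "d \<in> ?I" "d \<noteq> 0"
    and least: "\<And>e. e \<in> ?I \<Longrightarrow> e \<noteq> 0 \<Longrightarrow> degree d \<le> degree e"
    using ex_has_least_nat[of "\<lambda>d. d \<in> ?I \<and> d \<noteq> 0" a degree] assms(1) by blast
  have dvd: "d dvd w" if w: "w \<in> ?I" for w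
  proof -
    obtain u v u' v' where uv: "d = u * a + v * b" "w = u' * a + v' * b"
      using d w by auto
    have "w mod d = w - (w div d) * d"
      by (simp add: minus_div_mult_eq_mod)
    also have "\<dots> = (u' - (w div d) * u) * a + (v' - (w div d) * v) * b"
      by (subst (2) uv(1), subst (1) uv(2)) (simp add: algebra_simps)
    finally have "w mod d \<in> ?I" by blast
    then have "w mod d = 0"
      using least degree_mod_less'[OF d(2), of w] by force
    then show ?thesis by auto
  qed
  have "degree d = 0"
    using dvd \<open>a \<in> ?I\<close> \<open>b \<in> ?I\<close> assms(2) by blast
  then obtain k where k: "d = [:k:]"
    by (rule degree_eq_zeroE)
  with d obtain u v where "u * a + v * b = [:k:]" "k \<noteq> 0"
    by auto
  then have "smult (1 / k) u * a + smult (1 / k) v * b = 1"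
    by (simp flip: smult_add_right)
  then show ?thesis by (rule that)
qed

text \<open>
  The radical is obtained as a polynomial \<open>s\<close> of least degree among those with a power divisible
  by \<open>r\<close>. If \<open>s\<close> and \<open>s'\<close> had a nonconstant common divisor \<open>p\<close>, one of least degree would be
  coprime to \<open>p'\<close>. Writing \<open>s = p t\<close>, it would divide \<open>p' t\<close> and hence \<open>t\<close>, so that \<open>s\<close> divides
  \<open>t\<^sup>2\<close>, and \<open>t\<close> would be a candidate of smaller degree.
\<close>

lemma radical_exists:
  fixes r :: "'a::field_char_0 poly"
  assumes "r \<noteq> 0"
  obtains s N u v where "r dvd s ^ N" "u * s + v * pderiv s = 1"
proof -
  obtain s where s: "s \<noteq> 0" "\<exists>N. r dvd s ^ N"
    and least: "\<And>t. t \<noteq> 0 \<Longrightarrow> \<exists>N. r dvd t ^ N \<Longrightarrow> degree s \<le> degree t"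
    using ex_has_least_nat[of "\<lambda>s. s \<noteq> 0 \<and> (\<exists>N. r dvd s ^ N)" r degree] assms
    by (metis dvd_refl power_one_right)
  have "degree d = 0" if "d dvd s" "d dvd pderiv s" for d
  proof (rule ccontr)
    assume "degree d \<noteq> 0"
    with that obtain p where p: "p dvd s" "p dvd pderiv s" "degree p \<noteq> 0"
      and p_least: "\<And>q. q dvd s \<Longrightarrow> q dvd pderiv s \<Longrightarrow> degree q \<noteq> 0 \<Longrightarrow> degree p \<le> degree q"
      using ex_has_least_nat[of "\<lambda>p. p dvd s \<and> p dvd pderiv s \<and> degree p \<noteq> 0" d degree]
      by blast
    have coprime: "degree q = 0" if q: "q dvd p" "q dvd pderiv p" for q
    proof (rule ccontr)
      assume "degree q \<noteq> 0"
      then have "degree p \<le> degree q"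
        using p_least q p dvd_trans by blast
      also have "\<dots> \<le> degree (pderiv p)"
        using q(2) p(3) by (intro dvd_imp_degree_le) (auto simp: pderiv_eq_0_iff)
      finally show False
        using p(3) by (simp add: degree_pderiv)
    qed
    have "p \<noteq> 0"
      using p(3) by auto
    from this coprime obtain a b where ab: "a * p + b * pderiv p = 1"
      by (rule bezout_of_no_common_divisor)
    obtain t where t: "s = p * t"
      using p(1) by blast
    have "t = a * p * t + b * (pderiv p * t)"
      using arg_cong[OF ab, of "\<lambda>w. w * t"] by (simp add: algebra_simps)
    moreover have "p dvd pderiv p * t"
      using p(2) unfolding t pderiv_mult by (metis dvd_add_right_iff dvd_triv_left mult.commute)
    ultimately have "p dvd t"
      by (metis dvd_add dvd_mult dvd_mult2 dvd_triv_right)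
    then have "s dvd t ^ 2"
      unfolding t power2_eq_square by (rule mult_dvd_mono) simp
    moreover obtain N where "r dvd s ^ N"
      using s(2) by blast
    ultimately have "r dvd t ^ (2 * N)"
      by (metis dvd_power_same dvd_trans power_mult)
    moreover have "t \<noteq> 0" "degree t < degree s"
      using s(1) p(3) t by (auto simp: degree_mult_eq)
    ultimately show False
      using least[of t] by force
  qed
  with s(1) obtain u v where "u * s + v * pderiv s = 1"
    by (rule bezout_of_no_common_divisor)
  with s(2) show ?thesis
    using that by blast
qed

text \<open>
  To pass from \<open>y' = s\<^sup>k m\<close> to the next power of \<open>s\<close>, replace \<open>y\<close> by \<open>y + s\<^sup>k\<^sup>+\<^sup>1 t\<close>. Modulo
  \<open>s\<^sup>k\<^sup>+\<^sup>1\<close>, the derivative becomes \<open>s\<^sup>k (m + (k + 1) s' t)\<close>. This vanishes for a suitable \<open>t\<close>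
  because \<open>s'\<close> is invertible modulo \<open>s\<close>, with inverse \<open>v\<close>, and the characteristic is \<open>0\<close>.
\<close>

lemma flat_lift_exists:
  fixes s :: "'a::field_char_0 poly"
  assumes uv: "u * s + v * pderiv s = 1"
  shows "\<exists>y. s dvd y - [:0, 1:] \<and> s ^ k dvd pderiv y"
proof (induction k)
  case 0
  show ?case by (intro exI[of _ "[:0, 1:]"]) simp
next
  case (Suc k)
  then obtain y where y: "s dvd y - [:0, 1:]" and "s ^ k dvd pderiv y"
    by blast
  then obtain m where m: "pderiv y = s ^ k * m"
    by blast
  define t where "t = smult (- 1 / of_nat (Suc k)) (v * m)"
  have t: "smult (of_nat (Suc k)) t = - (v * m)"
    unfolding t_def by (simp del: of_nat_Suc)
  have "pderiv (y + s ^ Suc k * t) =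
      s ^ k * m + s ^ k * pderiv s * smult (of_nat (Suc k)) t + s ^ Suc k * pderiv t"
    by (simp add: pderiv_add pderiv_mult pderiv_power_Suc m algebra_simps del: of_nat_Suc power_Suc)
  also have "\<dots> = s ^ k * (m * (1 - v * pderiv s)) + s ^ Suc k * pderiv t"
    unfolding t by (simp add: algebra_simps)
  also have "1 - v * pderiv s = u * s"
    using uv by (simp add: algebra_simps)
  finally have "pderiv (y + s ^ Suc k * t) = s ^ Suc k * (m * u + pderiv t)"
    by (simp add: algebra_simps)
  moreover have "s dvd y + s ^ Suc k * t - [:0, 1:]"
    using dvd_add[OF y, of "s ^ Suc k * t"] by (simp add: algebra_simps)
  ultimately show ?case
    by (metis dvd_triv_left)
qed

lemma diff_dvd_pcompose_diff:
  fixes y w :: "'a::comm_ring_1 poly"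
  shows "(y - [:0, 1:]) dvd (w \<circ>\<^sub>p y - w)"
proof (induction w)
  case 0
  show ?case by simp
next
  case (pCons c w)
  define x :: "'a poly" where "x = [:0, 1:]"
  have w: "pCons c w = [:c:] + x * w"
    by (simp add: x_def)
  have "pCons c w \<circ>\<^sub>p y - pCons c w = y * (w \<circ>\<^sub>p y - w) + (y - x) * w"
    by (subst pcompose_pCons, subst w) (simp add: algebra_simps)
  with pCons(2) show ?case by (simp add: x_def)
qed

section \<open>Characters of the algebra of integrals of multiples of a polynomial\<close>

text \<open>
  A character of the algebra of all \<open>w\<close> with \<open>w'\<close> divisible by \<open>r\<close>. The values of \<open>\<chi>\<close> outside
  this algebra are unconstrained.
\<close>

locale integral_algebra_character =
  fixes r :: "'a::field_char_0 poly" and \<chi> :: "'a poly \<Rightarrow> 'a"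
  assumes r_nonzero: "r \<noteq> 0"
    and \<chi>_const: "\<chi> [:c:] = c"
    and \<chi>_add: "r dvd pderiv w \<Longrightarrow> r dvd pderiv w' \<Longrightarrow> \<chi> (w + w') = \<chi> w + \<chi> w'"
    and \<chi>_mult: "r dvd pderiv w \<Longrightarrow> r dvd pderiv w' \<Longrightarrow> \<chi> (w * w') = \<chi> w * \<chi> w'"
begin

lemma \<chi>_smult:
  assumes "r dvd pderiv w"
  shows "\<chi> (smult c w) = c * \<chi> w"
  using \<chi>_mult[of "[:c:]" w] assms by (simp add: \<chi>_const pderiv_pCons)

lemma \<chi>_diff:
  assumes "r dvd pderiv w" "r dvd pderiv w'"
  shows "\<chi> (w - w') = \<chi> w - \<chi> w'"
  using \<chi>_add[of "w - w'" w'] assms by (simp add: pderiv_diff)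

lemma \<chi>_power:
  assumes "r dvd pderiv w"
  shows "\<chi> (w ^ n) = \<chi> w ^ n"
proof (induction n)
  case 0
  show ?case using \<chi>_const[of 1] by (simp add: one_pCons)
next
  case (Suc n)
  have "r dvd pderiv (w ^ n)"
    using assms by (simp add: pderiv_power dvd_smult)
  with assms Suc show ?case by (simp add: \<chi>_mult)
qed

lemma \<chi>_pcompose:
  assumes "r dvd pderiv y"
  shows "\<chi> (w \<circ>\<^sub>p y) = poly w (\<chi> y)"
proof (induction w)
  case 0
  show ?case using \<chi>_const[of 0] by simp
next
  case (pCons c w)
  have "r dvd pderiv (w \<circ>\<^sub>p y)"
    using assms by (simp add: pderiv_pcompose)
  with assms pCons show ?case
    by (simp add: pcompose_pCons \<chi>_add \<chi>_mult \<chi>_const pderiv_mult pderiv_pCons)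
qed

text \<open>
  The multiples of \<open>r\<^sup>2\<close> form an ideal of all of \<open>F[x]\<close> inside the domain of \<open>\<chi>\<close>. Therefore
  \<open>f \<mapsto> \<chi>(f h) / \<chi>(h)\<close> is defined for every polynomial \<open>f\<close>. It is multiplicative because
  \<open>(f g h) h = (f h) (g h)\<close>, and it extends \<open>\<chi>\<close>. The point is its value at \<open>x\<close>.
\<close>

lemma evaluation_if_nonzero_on_conductor:
  assumes h: "r ^ 2 dvd h" "\<chi> h \<noteq> 0"
  shows "\<exists>a. \<forall>w. r dvd pderiv w \<longrightarrow> \<chi> w = poly w a"
proof -
  have r: "r dvd pderiv (f * h)" for f
  proof -
    obtain g where "h = r ^ 2 * g"
      using h(1) by blast
    then have eq: "f * h = r * (r * (f * g))"
      by (simp add: power2_eq_square mult_ac)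
    show ?thesis
      unfolding eq pderiv_mult[of r] by (intro dvd_add) simp_all
  qed
  have rh: "r dvd pderiv h"
    using r[of 1] by simp
  define \<psi> where "\<psi> f = \<chi> (f * h) / \<chi> h" for f
  define x :: "'a poly" where "x = [:0, 1:]"
  have mult: "\<psi> (f * g) = \<psi> f * \<psi> g" for f g
  proof -
    have "\<chi> (f * g * h) * \<chi> h = \<chi> (f * h) * \<chi> (g * h)"
      using \<chi>_mult[OF r[of "f * g"] rh] \<chi>_mult[OF r[of f] r[of g]] by (simp add: mult_ac)
    then show ?thesis
      using h(2) by (simp add: \<psi>_def field_simps)
  qed
  have eval: "\<psi> f = poly f (\<psi> x)" for f
  proof (induction f)
    case 0
    show ?case using \<chi>_const[of 0] by (simp add: \<psi>_def)
  next
    case (pCons c f)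
    have "pCons c f * h = smult c h + x * f * h"
      by (simp add: x_def)
    then have "\<psi> (pCons c f) = c + \<psi> (x * f)"
      using h(2) rh r[of "x * f"] by (simp add: \<psi>_def \<chi>_add \<chi>_smult pderiv_smult dvd_smult field_simps)
    with pCons show ?case by (simp add: mult)
  qed
  have "\<chi> w = poly w (\<psi> x)" if "r dvd pderiv w" for w
    using \<chi>_mult[OF that rh] h(2) unfolding eval[symmetric] by (simp add: \<psi>_def)
  then show ?thesis by blast
qed

text \<open>
  The flat lift \<open>y\<close> of \<open>x\<close> belongs to the domain of \<open>\<chi>\<close>, so its value \<open>\<chi>(y)\<close> is a point
  of \<open>F\<close>. Replacing \<open>w\<close> by \<open>w(y)\<close> changes \<open>w\<close> by a multiple of \<open>s\<close>, which is nilpotent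
  modulo \<open>r\<^sup>2\<close> and hence killed by \<open>\<chi>\<close>.
\<close>

lemma evaluation_if_zero_on_conductor:
  assumes zero: "\<And>h. r ^ 2 dvd h \<Longrightarrow> \<chi> h = 0"
  shows "\<exists>a. \<forall>w. r dvd pderiv w \<longrightarrow> \<chi> w = poly w a"
proof -
  obtain s N u v where s: "r dvd s ^ N" "u * s + v * pderiv s = 1"
    using radical_exists[OF r_nonzero] by blast
  obtain y where y: "s dvd y - [:0, 1:]" "s ^ N dvd pderiv y"
    using flat_lift_exists[OF s(2)] by blast
  have ry: "r dvd pderiv y"
    using s(1) y(2) by (rule dvd_trans)
  have "\<chi> w = poly w (\<chi> y)" if w: "r dvd pderiv w" for w
  proof -
    have rwy: "r dvd pderiv (w \<circ>\<^sub>p y)"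
      using ry by (simp add: pderiv_pcompose)
    have "s dvd w \<circ>\<^sub>p y - w"
      using y(1) diff_dvd_pcompose_diff by (rule dvd_trans)
    then have "s ^ (N * 2) dvd (w \<circ>\<^sub>p y - w) ^ (N * 2)"
      by (rule dvd_power_same)
    moreover have "r ^ 2 dvd s ^ (N * 2)"
      unfolding power_mult using s(1) by (rule dvd_power_same)
    ultimately have "\<chi> ((w \<circ>\<^sub>p y - w) ^ (N * 2)) = 0"
      using zero dvd_trans by blast
    then have "\<chi> (w \<circ>\<^sub>p y - w) = 0"
      using \<chi>_power[of "w \<circ>\<^sub>p y - w" "N * 2"] w rwy by (simp add: pderiv_diff)
    then show ?thesis
      using \<chi>_diff[OF rwy w] \<chi>_pcompose[OF ry, of w] by simp
  qed
  then show ?thesis by blast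
qed

lemma character_is_evaluation: "\<exists>a. \<forall>w. r dvd pderiv w \<longrightarrow> \<chi> w = poly w a"
  using evaluation_if_nonzero_on_conductor evaluation_if_zero_on_conductor by blast

end

section \<open>Injective Rota--Baxter operators\<close>

lemma eq_formal_integral:
  fixes g :: "'a::field_char_0 poly"
  assumes "pderiv g = f" "poly g a = 0"
  shows "g = formal_integral a f"
proof -
  have "pderiv (formal_integral a f) = (\<Sum>n\<le>degree f. monom (coeff f n) n)"
    unfolding formal_integral_def
    by (simp add: higher_pderiv_sum[of 1, simplified] pderiv_smult pderiv_diff pderiv_monom pderiv_pCons smult_monom
        del: of_nat_Suc)
  then have "pderiv (g - formal_integral a f) = 0"
    using assms(1) by (simp add: pderiv_diff poly_as_sum_of_monoms)
  then obtain c where c: "g - formal_integral a f = [:c:]"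
    by (metis degree_eq_zeroE pderiv_eq_0_iff)
  have "poly (formal_integral a f) a = 0"
    unfolding formal_integral_def by (simp add: poly_sum poly_monom)
  then have "c = 0"
    using arg_cong[OF c, of "\<lambda>p. poly p a"] assms(2) by simp
  with c show ?thesis by simp
qed

theorem theorem3p8:
  fixes R :: "'a::field_char_0 poly \<Rightarrow> 'a poly"
  assumes "rota_baxter_weight_zero smult R"
    and "inj R"
  shows "\<exists>r a. r \<noteq> 0 \<and> R = formal_integral a \<circ> (\<lambda>f. r * f)"
proof -
  interpret rota_baxter_weight_zero smult R by (rule assms(1))
  have R0: "R 0 = 0" by (rule zero)
  have R_eq_0: "f = 0" if "R f = 0" for f
    using injD[OF assms(2), of f 0] R0 that by simp
  \<comment> \<open>The image of \<open>R\<close> contains no constant \<open>k \<noteq> 0\<close>: the identity would give \<open>k\<^sup>2 = 2 k\<^sup>2\<close>.\<close>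
  have R_const: "f = 0" if "R f = [:k:]" for f k
  proof -
    have "[:k * k:] = R f * R f"
      using that by simp
    also have "\<dots> = R (smult (2 * k) f)"
      using rota_baxter[of f f] that by (simp flip: smult_add_left)
    also have "\<dots> = [:2 * (k * k):]"
      unfolding scale using that by simp
    finally have "k = 0" by simp
    with that R_eq_0 show ?thesis by simp
  qed
  \<comment> \<open>The inverse of \<open>R\<close>, extended by \<open>0\<close> on constants to make its domain unital.\<close>
  define D where "D w e \<longleftrightarrow> (\<exists>c. w = [:c:] + R e)" for w e
  interpret derivation_relation D
  proof
    show "D [:c:] 0" for c
      by (simp add: D_def R0)
    show "D (w + w') (e + e')" if "D w e" "D w' e'" for w e w' e'
    proof -
      from that obtain c c' where "w = [:c:] + R e" "w' = [:c':] + R e'"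
        by (auto simp: D_def)
      then have "w + w' = [:c + c':] + R (e + e')"
        by (simp add: add algebra_simps)
      then show ?thesis by (auto simp: D_def)
    qed
    show "D (w * w') (w * e' + e * w')" if "D w e" "D w' e'" for w e w' e'
    proof -
      from that obtain c c' where c: "w = [:c:] + R e" "w' = [:c':] + R e'"
        by (auto simp: D_def)
      have "w * w' = [:c * c':] + smult c (R e') + smult c' (R e) + R e * R e'"
        by (simp add: c algebra_simps)
      also have "\<dots> = [:c * c':] + R (smult c e' + smult c' e + (R e * e' + e * R e'))"
        by (simp add: rota_baxter add scale)
      also have "smult c e' + smult c' e + (R e * e' + e * R e') = w * e' + e * w'"
        by (simp add: c algebra_simps)
      finally show ?thesis by (auto simp: D_def)
    qed
  qed
  have D_R: "D (R f) f" for f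
    unfolding D_def by (rule exI[of _ 0]) simp
  have D_0: "e = 0" if "D 0 e" for e
  proof -
    from that obtain c where "0 = [:c:] + R e" by (auto simp: D_def)
    then have "R e = [:- c:]"
      by (metis add_eq_0_iff minus_pCons minus_zero)
    then show ?thesis by (rule R_const)
  qed
  define r where "r = pderiv (R 1)"
  have deg: "degree (R 1) \<noteq> 0"
    using R_const degree_eq_zeroE by (metis zero_neq_one)
  then have r: "r \<noteq> 0"
    by (simp add: r_def pderiv_eq_0_iff)
  have pderiv_R: "pderiv (R f) = r * f" for f
    using D_proportional_pderiv[OF D_0 D_R[of 1] D_R[of f] deg] by (simp add: r_def mult.commute)
  \<comment> \<open>The domain of \<open>D\<close> is thus the whole algebra of \<open>w\<close> with \<open>w'\<close> divisible by \<open>r\<close>.\<close>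
  have D_pderiv: "D w e" if "pderiv w = r * e" for w e
  proof -
    have "pderiv (w - R e) = 0"
      using that by (simp add: pderiv_diff pderiv_R)
    then obtain c where "w - R e = [:c:]"
      by (metis degree_eq_zeroE pderiv_eq_0_iff)
    then show ?thesis
      by (auto simp: D_def algebra_simps)
  qed
  \<comment> \<open>The projection to the constants along the image of \<open>R\<close>; the coefficient is taken from a
    polynomial that is constant on the algebra in question.\<close>
  define \<chi> where "\<chi> w = coeff (w - R (pderiv w div r)) 0" for w
  have \<chi>_eq: "\<chi> ([:c:] + R e) = c" for c e
    using r by (simp add: \<chi>_def pderiv_add pderiv_pCons pderiv_R)
  have split: "w = [:\<chi> w:] + R (pderiv w div r)" if "r dvd pderiv w" for w
  proof -
    have "D w (pderiv w div r)"
      by (rule D_pderiv) (use that in simp)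
    then obtain c where "w = [:c:] + R (pderiv w div r)"
      by (auto simp: D_def)
    with \<chi>_eq show ?thesis by metis
  qed
  interpret integral_algebra_character r \<chi>
  proof
    show "r \<noteq> 0" by (rule r)
    show "\<chi> [:c:] = c" for c
      using \<chi>_eq[of c 0] R0 by simp
    fix w w' assume w: "r dvd pderiv w" "r dvd pderiv w'"
    let ?e = "pderiv w div r" and ?e' = "pderiv w' div r"
    have "w + w' = [:\<chi> w + \<chi> w':] + R (?e + ?e')"
      by (subst split[OF w(1)], subst split[OF w(2)]) (simp add: add algebra_simps)
    then show "\<chi> (w + w') = \<chi> w + \<chi> w'"
      using \<chi>_eq by metis
    have "w * w' = [:\<chi> w:] * [:\<chi> w':] + smult (\<chi> w) (R ?e') + smult (\<chi> w') (R ?e) + R ?e * R ?e'"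
      by (subst split[OF w(1)], subst split[OF w(2)]) (simp add: algebra_simps)
    also have "\<dots> = [:\<chi> w * \<chi> w':] + R (smult (\<chi> w) ?e' + smult (\<chi> w') ?e + (R ?e * ?e' + ?e * R ?e'))"
      by (simp add: rota_baxter add scale)
    finally show "\<chi> (w * w') = \<chi> w * \<chi> w'"
      using \<chi>_eq by metis
  qed
  obtain a where a: "\<And>w. r dvd pderiv w \<Longrightarrow> \<chi> w = poly w a"
    using character_is_evaluation by blast
  have "R f = formal_integral a (r * f)" for f
  proof (rule eq_formal_integral)
    show "pderiv (R f) = r * f" by (rule pderiv_R)
    show "poly (R f) a = 0"
      using a[of "R f"] \<chi>_eq[of 0 f] by (simp add: pderiv_R)
  qed
  with r show ?thesis
    by (intro exI[of _ r] exI[of _ a]) auto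
qed

end
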